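(* Let $k$ be a positive integer and let $H_1$ and $H_2$ be $k$-uniform 2-line existentially closed hypergraphs on disjoint vertex sets $V(H_1)$ and $V(H_2)$. Let $H$ be the hypergraph with vertex set $V(H_1)\cup V(H_2)$ whose edges are the edges of $H_1$, the edges of $H_2$, and all subsets of $V(H_1)\cup V(H_2)$ of size $k$ having non-empty intersection with both $V(H_1)$ and $V(H_2)$. If $|V(H_1)|\geq|V(H_2)|\geq 2k-1$, then $H$ is a $k$-uniform 2-line existentially closed hypergraph.
   Context: A hypergraph is a pair $(V,E)$ with $V$ a set of vertices and $E$ a collection of subsets of $V$ called edges; it is $k$-uniform if all edges have cardinality $k$. Two distinct edges are adjacent if they share at least one vertex. A hypergraph with at least two edges is 2-line existentially closed (2-line e.c.) if, for all disjoint sets of edges $A$ and $B$ with $|A\cup B|=2$ (either may be empty), there is an edge $e\notin A\cup B$ that is adjacent to each edge of $A$ and to no edge of $B$. Equivalently, the line graph of the hypergraph (vertices are the edges of the hypergraph, adjacency being edge adjacency) is 2-existentially closed. *)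

theory Defs
  imports Main "HOL-Library.Equipollence"
begin

text \<open>Vertex sets and edge sets may be infinite; a set of sets has no repeated edges.\<close>

type_synonym 'a hypergraph = "'a set \<times> 'a set set"

abbreviation verts :: "'a hypergraph \<Rightarrow> 'a set" where
  "verts H \<equiv> fst H"

abbreviation edges :: "'a hypergraph \<Rightarrow> 'a set set" where
  "edges H \<equiv> snd H"

definition is_hypergraph :: "'a hypergraph \<Rightarrow> bool" where
  "is_hypergraph H \<longleftrightarrow> (\<forall>e\<in>edges H. e \<subseteq> verts H)"

text \<open>For \<open>k = 0\<close> infinite edges would also qualify, since \<open>card\<close> is \<open>0\<close> on
  infinite sets; the notion is only meant for \<open>k > 0\<close>.\<close>

definition uniform :: "nat \<Rightarrow> 'a hypergraph \<Rightarrow> bool" where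
  "uniform k H \<longleftrightarrow> (\<forall>e\<in>edges H. card e = k)"

definition adjacent :: "'a set \<Rightarrow> 'a set \<Rightarrow> bool" where
  "adjacent e f \<longleftrightarrow> e \<noteq> f \<and> e \<inter> f \<noteq> {}"

definition two_line_ec :: "'a hypergraph \<Rightarrow> bool" where
  "two_line_ec H \<longleftrightarrow>
     (\<exists>e\<in>edges H. \<exists>f\<in>edges H. e \<noteq> f) \<and>
     (\<forall>A B. A \<subseteq> edges H \<longrightarrow> B \<subseteq> edges H \<longrightarrow> A \<inter> B = {} \<longrightarrow> card (A \<union> B) = 2 \<longrightarrow>
        (\<exists>e\<in>edges H. e \<notin> A \<union> B \<and> (\<forall>a\<in>A. adjacent e a) \<and> (\<forall>b\<in>B. \<not> adjacent e b)))"

definition uniform_join :: "nat \<Rightarrow> 'a hypergraph \<Rightarrow> 'a hypergraph \<Rightarrow> 'a hypergraph" where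
  "uniform_join k H1 H2 =
     (verts H1 \<union> verts H2,
      edges H1 \<union> edges H2 \<union>
      {e. e \<subseteq> verts H1 \<union> verts H2 \<and> card e = k \<and>
          e \<inter> verts H1 \<noteq> {} \<and> e \<inter> verts H2 \<noteq> {}})"

end

theory Submission imports Defs begin

text \<open>Every required edge that \<open>H1\<close> or \<open>H2\<close> does not supply itself is a crossing edge, and any two
  vertices on opposite sides extend to a crossing edge avoiding a prescribed set of at most \<open>2 * k\<close>
  other vertices. Only the choice of the two vertices matters. A crossing edge has at most \<open>k - 1\<close>
  vertices on either side, so two of them never cover a side, as each side has at least \<open>2 * k - 1\<close>
  vertices. The one exception is the edge avoiding an edge \<open>a\<close> of \<open>H1\<close> and a crossing edge \<open>b\<close>
  when \<open>a \<union> b\<close> covers the first side: then \<open>b\<close> has a single vertex on the second side, and some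
  edge of \<open>H2\<close> misses it.\<close>

section \<open>The 2-line e.c. property as a condition on pairs of edges\<close>

text \<open>The four conjuncts are the four ways to distribute \<open>a\<close> and \<open>b\<close>
  over \<open>A\<close> and \<open>B\<close>. All of them demand that \<open>e\<close> differ from
  both, since \<open>adjacent\<close> alone would let \<open>e\<close> equal an edge that it has to
  avoid.\<close>

definition realizes_all :: "'a set set \<Rightarrow> 'a set \<Rightarrow> 'a set \<Rightarrow> bool" where
  "realizes_all E a b \<longleftrightarrow>
     (\<exists>e\<in>E. e \<noteq> a \<and> e \<noteq> b \<and> e \<inter> a \<noteq> {} \<and> e \<inter> b \<noteq> {}) \<and>
     (\<exists>e\<in>E. e \<noteq> a \<and> e \<noteq> b \<and> e \<inter> a \<noteq> {} \<and> e \<inter> b = {}) \<and>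
     (\<exists>e\<in>E. e \<noteq> a \<and> e \<noteq> b \<and> e \<inter> a = {} \<and> e \<inter> b \<noteq> {}) \<and>
     (\<exists>e\<in>E. e \<noteq> a \<and> e \<noteq> b \<and> e \<inter> a = {} \<and> e \<inter> b = {})"

lemma realizes_all_commute: "realizes_all E a b \<longleftrightarrow> realizes_all E b a"
  unfolding realizes_all_def by meson

lemma realizes_all_mono: "realizes_all E a b \<Longrightarrow> E \<subseteq> F \<Longrightarrow> realizes_all F a b"
  unfolding realizes_all_def by (meson subsetD)

text \<open>Once \<open>e\<close> lies outside \<open>A \<union> B\<close>, adjacency is just
  non-empty intersection. This form allows a case analysis on the kinds of edges that
  \<open>a\<close> and \<open>b\<close> are.\<close>

lemma two_line_ec_iff:
  "two_line_ec H \<longleftrightarrow>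
     (\<exists>e\<in>edges H. \<exists>f\<in>edges H. e \<noteq> f) \<and>
     (\<forall>a\<in>edges H. \<forall>b\<in>edges H. a \<noteq> b \<longrightarrow> realizes_all (edges H) a b)"
  (is "_ \<longleftrightarrow> ?ne \<and> ?all")
proof
  assume H: "two_line_ec H"
  have "realizes_all (edges H) a b" if ab: "a \<in> edges H" "b \<in> edges H" "a \<noteq> b" for a b
  proof -
    have ex: "\<exists>e\<in>edges H. e \<notin> A \<union> B \<and> (\<forall>a\<in>A. adjacent e a) \<and> (\<forall>b\<in>B. \<not> adjacent e b)"
      if "A \<union> B = {a, b}" "A \<inter> B = {}" for A B
    proof -
      have "A \<subseteq> edges H" "B \<subseteq> edges H" "card (A \<union> B) = 2"
        using that(1) ab by auto
      with H that(2) show ?thesis unfolding two_line_ec_def by blast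
    qed
    show ?thesis unfolding realizes_all_def
    proof (intro conjI)
      show "\<exists>e\<in>edges H. e \<noteq> a \<and> e \<noteq> b \<and> e \<inter> a \<noteq> {} \<and> e \<inter> b \<noteq> {}"
        using ex[of "{a, b}" "{}"] ab(3) by (simp add: adjacent_def) blast
      show "\<exists>e\<in>edges H. e \<noteq> a \<and> e \<noteq> b \<and> e \<inter> a \<noteq> {} \<and> e \<inter> b = {}"
        using ex[of "{a}" "{b}"] ab(3) by (simp add: adjacent_def) blast
      show "\<exists>e\<in>edges H. e \<noteq> a \<and> e \<noteq> b \<and> e \<inter> a = {} \<and> e \<inter> b \<noteq> {}"
        using ex[of "{b}" "{a}"] ab(3) by (simp add: adjacent_def) blast
      show "\<exists>e\<in>edges H. e \<noteq> a \<and> e \<noteq> b \<and> e \<inter> a = {} \<and> e \<inter> b = {}"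
        using ex[of "{}" "{a, b}"] ab(3) by (simp add: adjacent_def) blast
    qed
  qed
  with H show "?ne \<and> ?all" unfolding two_line_ec_def by blast
next
  assume H: "?ne \<and> ?all"
  have "\<exists>e\<in>edges H. e \<notin> A \<union> B \<and> (\<forall>a\<in>A. adjacent e a) \<and> (\<forall>b\<in>B. \<not> adjacent e b)"
    if AB: "A \<subseteq> edges H" "B \<subseteq> edges H" "A \<inter> B = {}" "card (A \<union> B) = 2" for A B
  proof -
    obtain a b where ab: "A \<union> B = {a, b}" "a \<noteq> b"
      using AB(4) by (auto simp: card_2_iff)
    then have "a \<in> edges H" "b \<in> edges H" using AB(1,2) by auto
    with H ab(2) have r: "realizes_all (edges H) a b" by blast
    consider "A = {a, b}" "B = {}" | "A = {a}" "B = {b}" | "A = {b}" "B = {a}" | "A = {}" "B = {a, b}"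
    proof -
      \<comment> \<open>Disjointness makes \<open>B\<close> the complement of \<open>A\<close> in
        \<open>{a, b}\<close>, so the four subsets of \<open>{a, b}\<close> give all cases.\<close>
      have B: "B = {a, b} - A" using ab(1) AB(3) by blast
      have "A \<in> Pow {a, b}" using ab(1) by blast
      then have "A = {} \<or> A = {a} \<or> A = {b} \<or> A = {a, b}" by (auto simp: Pow_insert)
      then show thesis using that B ab(2) by (elim disjE) (simp_all add: insert_Diff_if)
    qed
    then show ?thesis
    proof cases
      case 1
      obtain e where "e \<in> edges H" "e \<noteq> a \<and> e \<noteq> b \<and> e \<inter> a \<noteq> {} \<and> e \<inter> b \<noteq> {}"
        using r[unfolded realizes_all_def, THEN conjunct1] by blast
      with 1 show ?thesis by (intro bexI[of _ e]) (simp_all add: adjacent_def)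
    next
      case 2
      obtain e where "e \<in> edges H" "e \<noteq> a \<and> e \<noteq> b \<and> e \<inter> a \<noteq> {} \<and> e \<inter> b = {}"
        using r[unfolded realizes_all_def, THEN conjunct2, THEN conjunct1] by blast
      with 2 show ?thesis by (intro bexI[of _ e]) (simp_all add: adjacent_def)
    next
      case 3
      obtain e where "e \<in> edges H" "e \<noteq> a \<and> e \<noteq> b \<and> e \<inter> a = {} \<and> e \<inter> b \<noteq> {}"
        using r[unfolded realizes_all_def, THEN conjunct2, THEN conjunct2, THEN conjunct1] by blast
      with 3 show ?thesis by (intro bexI[of _ e]) (simp_all add: adjacent_def)
    next
      case 4
      obtain e where "e \<in> edges H" "e \<noteq> a \<and> e \<noteq> b \<and> e \<inter> a = {} \<and> e \<inter> b = {}"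
        using r[unfolded realizes_all_def, THEN conjunct2, THEN conjunct2, THEN conjunct2] by blast
      with 4 show ?thesis by (intro bexI[of _ e]) (simp_all add: adjacent_def)
    qed
  qed
  with H show "two_line_ec H" by (simp add: two_line_ec_def)
qed

section \<open>Consequences for a single edge, a vertex and \<open>k\<close>\<close>

lemma two_line_ec_realizes:
  "two_line_ec H \<Longrightarrow> a \<in> edges H \<Longrightarrow> b \<in> edges H \<Longrightarrow> a \<noteq> b \<Longrightarrow> realizes_all (edges H) a b"
  by (simp add: two_line_ec_iff)

lemma two_line_ec_obtain_other_edge:
  assumes "two_line_ec H"
  obtains b where "b \<in> edges H" "a \<noteq> b"
proof -
  have "\<exists>e\<in>edges H. \<exists>f\<in>edges H. e \<noteq> f" using assms by (simp only: two_line_ec_def)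
  then show thesis using that by blast
qed

text \<open>The edge \<open>a\<close> is paired with any second edge, and only the condition
  relative to \<open>a\<close> is kept.\<close>

lemma two_line_ec_meeting_edge:
  assumes "two_line_ec H" "a \<in> edges H"
  obtains e where "e \<in> edges H" "e \<noteq> a" "e \<inter> a \<noteq> {}"
proof -
  obtain b where "b \<in> edges H" "a \<noteq> b" using two_line_ec_obtain_other_edge[OF assms(1)] .
  then have "realizes_all (edges H) a b" using two_line_ec_realizes assms by blast
  then have "\<exists>e\<in>edges H. e \<noteq> a \<and> e \<inter> a \<noteq> {}" unfolding realizes_all_def by meson
  then show thesis using that by blast
qed

lemma two_line_ec_disjoint_edge:
  assumes "two_line_ec H" "a \<in> edges H"
  obtains e where "e \<in> edges H" "e \<noteq> a" "e \<inter> a = {}"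
proof -
  obtain b where "b \<in> edges H" "a \<noteq> b" using two_line_ec_obtain_other_edge[OF assms(1)] .
  then have "realizes_all (edges H) a b" using two_line_ec_realizes assms by blast
  then have "\<exists>e\<in>edges H. e \<noteq> a \<and> e \<inter> a = {}" unfolding realizes_all_def by meson
  then show thesis using that by blast
qed

text \<open>Of two disjoint edges at most one contains \<open>v\<close>.\<close>

lemma two_line_ec_edge_avoiding_vertex:
  assumes "two_line_ec H"
  obtains e where "e \<in> edges H" "v \<notin> e"
proof -
  obtain c where c: "c \<in> edges H" using two_line_ec_obtain_other_edge[OF assms] .
  obtain d where "d \<in> edges H" "d \<inter> c = {}" using two_line_ec_disjoint_edge[OF assms c] .
  then show thesis using that c by blast
qed

text \<open>Singletons that meet are equal, so for \<open>k = 1\<close> no edge would have a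
  neighbour. From \<open>k = 2\<close> on, an edge has room for a vertex on each side.\<close>

lemma two_line_ec_uniform_ge_2:
  assumes "two_line_ec H" "uniform k H" "k > 0"
  shows "k \<ge> 2"
proof (rule ccontr)
  assume "\<not> k \<ge> 2"
  with \<open>k > 0\<close> have k: "k = 1" by simp
  obtain a where a: "a \<in> edges H" using two_line_ec_obtain_other_edge[OF assms(1)] .
  obtain e where e: "e \<in> edges H" "e \<noteq> a" "e \<inter> a \<noteq> {}"
    using two_line_ec_meeting_edge[OF assms(1) a] .
  have "card a = 1" "card e = 1" using assms(2) a e(1) k unfolding uniform_def by auto
  then show False using e by (auto simp: card_1_singleton_iff)
qed

section \<open>The setting of the join\<close>

text \<open>Vertex sets may be infinite, where \<open>card\<close> is 0, so their size is bounded by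
  \<open>\<lesssim>\<close>. This extracts a finite part to count with.\<close>

lemma card_lepoll_obtain_subset:
  assumes "{..<n::nat} \<lesssim> S"
  obtains T where "T \<subseteq> S" "finite T" "card T = n"
proof -
  obtain f where "inj_on f {..<n}" "f ` {..<n} \<subseteq> S" using assms unfolding lepoll_def by blast
  then show thesis using that[of "f ` {..<n}"] by (simp add: card_image)
qed

text \<open>Bounding both sides from below, instead of comparing them, makes the assumptions
  symmetric in \<open>H1\<close> and \<open>H2\<close>. Facts about the first side then carry over
  to the second by \<open>swap\<close>.\<close>

locale joinable =
  fixes k :: nat and H1 H2 :: "'a hypergraph"
  assumes k_ge_2: "k \<ge> 2"
    and hyper1: "is_hypergraph H1" and unif1: "uniform k H1" and ec1: "two_line_ec H1"
    and hyper2: "is_hypergraph H2" and unif2: "uniform k H2" and ec2: "two_line_ec H2"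
    and disjoint: "verts H1 \<inter> verts H2 = {}"
    and large1: "{..<2 * k - 1} \<lesssim> verts H1"
    and large2: "{..<2 * k - 1} \<lesssim> verts H2"
begin

definition crossing :: "'a set set" where
  "crossing = {e. e \<subseteq> verts H1 \<union> verts H2 \<and> card e = k \<and>
                  e \<inter> verts H1 \<noteq> {} \<and> e \<inter> verts H2 \<noteq> {}}"

abbreviation join_edges :: "'a set set" where
  "join_edges \<equiv> edges H1 \<union> edges H2 \<union> crossing"

lemma edges_join: "edges (uniform_join k H1 H2) = join_edges"
  by (simp add: uniform_join_def crossing_def)

lemma swap: "joinable k H2 H1"
  using k_ge_2 hyper1 unif1 ec1 hyper2 unif2 ec2 disjoint large1 large2
  by unfold_locales auto

lemma crossing_swap: "joinable.crossing k H2 H1 = crossing"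
  unfolding crossing_def joinable.crossing_def[OF swap] by auto

text \<open>For positive \<open>k\<close>, \<open>card a = k\<close> excludes the empty set and
  infinite sets alike, as \<open>card\<close> is 0 on both.\<close>

lemma edge1: "a \<in> edges H1 \<Longrightarrow> a \<subseteq> verts H1 \<and> card a = k \<and> finite a \<and> a \<noteq> {}"
  using hyper1 unif1 k_ge_2 unfolding is_hypergraph_def uniform_def
  by (metis card.empty card.infinite not_numeral_le_zero)

lemma edge2: "a \<in> edges H2 \<Longrightarrow> a \<subseteq> verts H2 \<and> card a = k \<and> finite a \<and> a \<noteq> {}"
  using joinable.edge1[OF swap] .

lemma crossingD:
  assumes "a \<in> crossing"
  shows "finite a" "card a = k" "a \<noteq> {}" "a \<subseteq> verts H1 \<union> verts H2"
    "a \<inter> verts H1 \<noteq> {}" "a \<inter> verts H2 \<noteq> {}"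
  using assms k_ge_2 unfolding crossing_def by (auto intro: card_ge_0_finite)

lemma crossing_card1:
  assumes "a \<in> crossing" shows "card (a \<inter> verts H1) < k"
proof -
  have "a \<inter> verts H1 \<subset> a" using crossingD[OF assms] disjoint by blast
  then show ?thesis using psubset_card_mono crossingD(1,2)[OF assms] by metis
qed

section \<open>Vertices outside given edges, and crossing edges through given vertices\<close>

lemma vertex1_outside:
  assumes "finite X" "card (X \<inter> verts H1) < 2 * k - 1"
  obtains x where "x \<in> verts H1" "x \<notin> X"
proof -
  obtain T where T: "T \<subseteq> verts H1" "finite T" "card T = 2 * k - 1"
    using card_lepoll_obtain_subset[OF large1] .
  have "\<not> T \<subseteq> X \<inter> verts H1"
    using card_mono[of "X \<inter> verts H1" T] assms T by auto
  then show thesis using that T by blast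
qed

lemma vertex1_outside_two_crossing:
  assumes "a \<in> crossing" "b \<in> crossing"
  obtains x where "x \<in> verts H1" "x \<notin> a" "x \<notin> b"
proof -
  have "card ((a \<union> b) \<inter> verts H1) \<le> card (a \<inter> verts H1) + card (b \<inter> verts H1)"
    by (simp add: Int_Un_distrib2 card_Un_le)
  \<comment> \<open>Each summand is at most \<open>k - 1\<close>, so the sum is at most
    \<open>2 * k - 2\<close>, one less than the guaranteed size of the side.\<close>
  then have "card ((a \<union> b) \<inter> verts H1) < 2 * k - 1"
    using assms[THEN crossing_card1] by linarith
  then show thesis
    using vertex1_outside[of "a \<union> b"] crossingD(1) assms that by auto
qed

lemmas vertex2_outside_two_crossing =
  joinable.vertex1_outside_two_crossing[OF swap, unfolded crossing_swap]

text \<open>Of \<open>4 * k - 2\<close> vertices taken from both sides, at least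
  \<open>2 * k - 2\<close> survive the removal of \<open>X\<close>, and this is at least
  \<open>k\<close> because \<open>k \<ge> 2\<close>. Any \<open>k\<close>-subset of the rest that
  contains \<open>x\<close> and \<open>y\<close> is crossing.\<close>

lemma crossing_edge_through:
  assumes "x \<in> verts H1" "y \<in> verts H2" "x \<notin> X" "y \<notin> X" "finite X" "card X \<le> 2 * k"
  obtains e where "e \<in> crossing" "x \<in> e" "y \<in> e" "e \<inter> X = {}"
proof -
  obtain S where S: "S \<subseteq> verts H1" "finite S" "card S = 2 * k - 1"
    using card_lepoll_obtain_subset[OF large1] .
  obtain T where T: "T \<subseteq> verts H2" "finite T" "card T = 2 * k - 1"
    using card_lepoll_obtain_subset[OF large2] .
  \<comment> \<open>\<open>x\<close> and \<open>y\<close> need not belong to \<open>S\<close> and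
    \<open>T\<close>, so they are adjoined.\<close>
  define U where "U = (S \<union> T - X) \<union> {x, y}"
  have "card (S \<union> T) = 4 * k - 2"
    using S T disjoint k_ge_2 by (subst card_Un_disjoint) auto
  moreover have "card (S \<union> T) - card X \<le> card (S \<union> T - X)"
    using diff_card_le_card_Diff assms(5) .
  moreover have "card (S \<union> T - X) \<le> card U"
    unfolding U_def using S T by (intro card_mono) auto
  ultimately have U: "k \<le> card U" using k_ge_2 assms(6) by linarith
  have "x \<noteq> y" using assms(1,2) disjoint by blast
  then have "card {x, y} = 2" by simp
  then obtain e where e: "{x, y} \<subseteq> e" "e \<subseteq> U" "card e = k"
    using exists_subset_between[of "{x, y}" k U] U k_ge_2 S(2) T(2) unfolding U_def by auto
  show thesis
    using that[of e] e assms S(1) T(1) unfolding crossing_def U_def by auto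
qed

section \<open>The kinds of pairs of edges\<close>

text \<open>Only the edge meeting both has to be crossing. An edge of one hypergraph automatically
  misses every edge of the other, which leaves a condition inside \<open>H1\<close> or
  \<open>H2\<close> for the other three.\<close>

lemma realizes_edges1_edges2:
  assumes a: "a \<in> edges H1" and b: "b \<in> edges H2"
  shows "realizes_all join_edges a b"
proof -
  note a' = edge1[OF a] and b' = edge2[OF b]
  obtain x y where xy: "x \<in> a" "y \<in> b" using a' b' by blast
  obtain e where e: "e \<in> crossing" "x \<in> e" "y \<in> e"
    using crossing_edge_through[of x y "{}"] xy a' b' by auto
  have "e \<noteq> a" "e \<noteq> b" using crossingD[OF e(1)] a' b' disjoint by auto
  obtain f where f: "f \<in> edges H1" "f \<noteq> a" "f \<inter> a \<noteq> {}"
    using two_line_ec_meeting_edge[OF ec1 a] .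
  obtain g where g: "g \<in> edges H2" "g \<noteq> b" "g \<inter> b \<noteq> {}"
    using two_line_ec_meeting_edge[OF ec2 b] .
  obtain h where h: "h \<in> edges H1" "h \<noteq> a" "h \<inter> a = {}"
    using two_line_ec_disjoint_edge[OF ec1 a] .
  have "f \<inter> b = {}" "g \<inter> a = {}" "h \<inter> b = {}"
    using edge1[OF f(1)] edge2[OF g(1)] edge1[OF h(1)] a' b' disjoint by blast+
  then have "f \<noteq> b" "g \<noteq> a" "h \<noteq> b" using a' b' f g edge1[OF h(1)] by auto
  show ?thesis unfolding realizes_all_def
  proof (intro conjI)
    show "\<exists>e\<in>join_edges. e \<noteq> a \<and> e \<noteq> b \<and> e \<inter> a \<noteq> {} \<and> e \<inter> b \<noteq> {}"
      using e xy \<open>e \<noteq> a\<close> \<open>e \<noteq> b\<close> by blast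
    show "\<exists>e\<in>join_edges. e \<noteq> a \<and> e \<noteq> b \<and> e \<inter> a \<noteq> {} \<and> e \<inter> b = {}"
      using f \<open>f \<inter> b = {}\<close> \<open>f \<noteq> b\<close> by blast
    show "\<exists>e\<in>join_edges. e \<noteq> a \<and> e \<noteq> b \<and> e \<inter> a = {} \<and> e \<inter> b \<noteq> {}"
      using g \<open>g \<inter> a = {}\<close> \<open>g \<noteq> a\<close> by blast
    show "\<exists>e\<in>join_edges. e \<noteq> a \<and> e \<noteq> b \<and> e \<inter> a = {} \<and> e \<inter> b = {}"
      using h \<open>h \<inter> b = {}\<close> \<open>h \<noteq> b\<close> by blast
  qed
qed

lemma edge_disjoint_from_edge1_and_crossing:
  assumes a: "a \<in> edges H1" and b: "b \<in> crossing"
  obtains e where "e \<in> join_edges" "e \<inter> a = {}" "e \<inter> b = {}"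
proof (cases "verts H1 \<subseteq> a \<union> b")
  case False
  note a' = edge1[OF a] and b' = crossingD[OF b]
  obtain x where x: "x \<in> verts H1" "x \<notin> a \<union> b" using False by blast
  obtain y where y: "y \<in> verts H2" "y \<notin> b" using vertex2_outside_two_crossing[OF b b] .
  have "card (a \<union> b) \<le> 2 * k" using card_Un_le[of a b] a' b'(2) by simp
  moreover have "y \<notin> a \<union> b" using y a' disjoint by blast
  moreover have "finite (a \<union> b)" using a' b'(1) by simp
  ultimately obtain e where "e \<in> crossing" "e \<inter> (a \<union> b) = {}"
    using crossing_edge_through[OF x(1) y(1) x(2)] by metis
  then show thesis using that by blast
next
  case True
  note a' = edge1[OF a] and b' = crossingD[OF b]
  \<comment> \<open>If \<open>a \<union> b\<close> covers the first side, it has at least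
    \<open>2 * k - 1\<close> vertices there. Only \<open>k\<close> of them come from
    \<open>a\<close>, so \<open>b\<close> has at least \<open>k - 1\<close> there and at most one on
    the second side.\<close>
  have "2 * k - 1 \<le> card ((a \<union> b) \<inter> verts H1)"
    using vertex1_outside[of "a \<union> b"] a' b'(1) True by (metis finite_UnI not_le subsetD)
  also have "\<dots> \<le> card a + card (b \<inter> verts H1)"
    using card_Un_le[of "a \<inter> verts H1" "b \<inter> verts H1"] a'
    by (simp add: Int_Un_distrib2 Int_absorb2)
  finally have ge: "k - 1 \<le> card (b \<inter> verts H1)" using a' by linarith
  have "card b = card (b \<inter> verts H1) + card (b \<inter> verts H2)"
    using b'(1,4) disjoint by (subst card_Un_disjoint[symmetric]) (auto intro: arg_cong[where f = card])
  then have "card (b \<inter> verts H2) \<le> Suc 0" using ge b'(2) by linarith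
  then obtain y where y: "b \<inter> verts H2 \<subseteq> {y}"
    using b'(1,6) by (metis card_le_Suc0_iff_eq finite_Int singleton_iff subsetI ex_in_conv)
  obtain e where "e \<in> edges H2" "y \<notin> e" using two_line_ec_edge_avoiding_vertex[OF ec2] .
  then show thesis using that[of e] y a' edge2 disjoint by blast
qed

lemma realizes_edges1_crossing:
  assumes a: "a \<in> edges H1" and b: "b \<in> crossing"
  shows "realizes_all join_edges a b"
proof -
  note a' = edge1[OF a] and b' = crossingD[OF b]
  obtain x where x: "x \<in> a" "x \<notin> b"
  proof -
    \<comment> \<open>Inclusion would force equality by cardinality, but \<open>b\<close> reaches
      the second side. The vertex \<open>x\<close> also keeps \<open>e\<close> and \<open>f\<close>
      distinct from \<open>b\<close>.\<close>
    have "\<not> a \<subseteq> b"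
      using a' b' disjoint card_subset_eq[of b a] by auto
    then show thesis using that by blast
  qed
  obtain y where y: "y \<in> b" "y \<in> verts H2" using b'(6) by blast
  obtain z where z: "z \<in> verts H2" "z \<notin> b" using vertex2_outside_two_crossing[OF b b] .
  obtain e where e: "e \<in> crossing" "x \<in> e" "y \<in> e"
    using crossing_edge_through[of x y "{}"] x y a' by auto
  obtain f where f: "f \<in> crossing" "x \<in> f" "z \<in> f" "f \<inter> b = {}"
    using crossing_edge_through[of x z b] x z a' b' by auto
  \<comment> \<open>If \<open>b\<close> misses \<open>a\<close>, then \<open>b\<close> itself avoids
    \<open>a\<close>, and \<open>g\<close> is kept distinct from it by \<open>z\<close>. If
    \<open>b\<close> meets \<open>a\<close>, avoiding \<open>a\<close> already separates
    \<open>g\<close> from \<open>b\<close>.\<close>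
  obtain g where g: "g \<in> crossing" "g \<inter> a = {}" "g \<inter> b \<noteq> {}" "g \<noteq> b"
  proof (cases "a \<inter> b = {}")
    case True
    obtain w where w: "w \<in> b" "w \<in> verts H1" using b'(5) by blast
    have "w \<notin> a" "z \<notin> a" using w z a' True disjoint by blast+
    then obtain g where "g \<in> crossing" "w \<in> g" "z \<in> g" "g \<inter> a = {}"
      using crossing_edge_through[of w z a] w z a' by auto
    then show thesis using that z w by blast
  next
    case False
    have "card (a \<inter> verts H1) < 2 * k - 1"
      using a' k_ge_2 by (simp add: Int_absorb2)
    then obtain w where w: "w \<in> verts H1" "w \<notin> a" using vertex1_outside[of a] a' by blast
    have "y \<notin> a" using y a' disjoint by blast
    then obtain g where "g \<in> crossing" "w \<in> g" "y \<in> g" "g \<inter> a = {}"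
      using crossing_edge_through[of w y a] w y a' by auto
    then show thesis using that[of g] y False by blast
  qed
  obtain h where h: "h \<in> join_edges" "h \<inter> a = {}" "h \<inter> b = {}"
    using edge_disjoint_from_edge1_and_crossing[OF a b] .
  have ne: "c \<noteq> a" if "c \<in> crossing" for c
    using crossingD(6)[OF that] a' disjoint by blast
  show ?thesis unfolding realizes_all_def
  proof (intro conjI)
    show "\<exists>e\<in>join_edges. e \<noteq> a \<and> e \<noteq> b \<and> e \<inter> a \<noteq> {} \<and> e \<inter> b \<noteq> {}"
      using e x y ne[OF e(1)] by blast
    show "\<exists>e\<in>join_edges. e \<noteq> a \<and> e \<noteq> b \<and> e \<inter> a \<noteq> {} \<and> e \<inter> b = {}"
      using f x z ne[OF f(1)] by blast
    show "\<exists>e\<in>join_edges. e \<noteq> a \<and> e \<noteq> b \<and> e \<inter> a = {} \<and> e \<inter> b \<noteq> {}"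
      using g ne[OF g(1)] by blast
    show "\<exists>e\<in>join_edges. e \<noteq> a \<and> e \<noteq> b \<and> e \<inter> a = {} \<and> e \<inter> b = {}"
      using h a' b'(3) by blast
  qed
qed

text \<open>The second vertex is taken opposite \<open>x\<close> and outside \<open>a\<close> and
  \<open>b\<close>, which makes \<open>e\<close> differ from both. The set \<open>X\<close> will be
  empty or all of \<open>a\<close>; \<open>c\<close> only places \<open>x\<close> on one of the
  sides.\<close>

lemma crossing_edge_through_vertex:
  assumes "x \<in> c" "c \<in> crossing" "a \<in> crossing" "b \<in> crossing" "X \<subseteq> a" "x \<notin> X"
  obtains e where "e \<in> crossing" "x \<in> e" "e \<inter> X = {}" "e \<noteq> a" "e \<noteq> b"
proof -
  have X: "finite X" "card X \<le> 2 * k"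
    using finite_subset[OF assms(5)] card_mono[OF _ assms(5)] crossingD[OF assms(3)] by auto
  obtain u where u: "u \<in> verts H1" "u \<notin> a" "u \<notin> b"
    using vertex1_outside_two_crossing[OF assms(3,4)] .
  obtain v where v: "v \<in> verts H2" "v \<notin> a" "v \<notin> b"
    using vertex2_outside_two_crossing[OF assms(3,4)] .
  consider "x \<in> verts H1" | "x \<in> verts H2" using crossingD(4) assms(1,2) by blast
  then show thesis
  proof cases
    case 1
    then show thesis
      using crossing_edge_through[of x v X] v X assms(5,6) that by blast
  next
    case 2
    then show thesis
      using crossing_edge_through[of u x X] u X assms(5,6) that by blast
  qed
qed

lemma crossing_edge_separating:
  assumes a: "a \<in> crossing" and b: "b \<in> crossing" and "a \<noteq> b"
  obtains e where "e \<in> crossing" "e \<inter> a \<noteq> {}" "e \<inter> b = {}" "e \<noteq> a" "e \<noteq> b"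
proof -
  have "\<not> a \<subseteq> b"
    using crossingD[OF a] crossingD[OF b] card_subset_eq[of b a] assms(3) by auto
  then obtain x where x: "x \<in> a" "x \<notin> b" by blast
  \<comment> \<open>The previous lemma is applied with \<open>a\<close> and \<open>b\<close>
    exchanged and with \<open>X = b\<close>.\<close>
  obtain e where "e \<in> crossing" "x \<in> e" "e \<inter> b = {}" "e \<noteq> b" "e \<noteq> a"
    using crossing_edge_through_vertex[OF x(1) a b a _ x(2)] by auto
  then show thesis using that x(1) by blast
qed

lemma realizes_crossing_crossing:
  assumes a: "a \<in> crossing" and b: "b \<in> crossing" and "a \<noteq> b"
  shows "realizes_all join_edges a b"
proof -
  note a' = crossingD[OF a] and b' = crossingD[OF b]
  obtain e where e: "e \<in> crossing" "e \<inter> a \<noteq> {}" "e \<inter> b \<noteq> {}" "e \<noteq> a" "e \<noteq> b"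
  \<comment> \<open>For disjoint \<open>a\<close> and \<open>b\<close>, a crossing edge through a
    vertex of each contains a vertex outside each. Otherwise one common vertex suffices for meeting
    both.\<close>
  proof (cases "a \<inter> b = {}")
    case True
    obtain x y where "x \<in> a \<inter> verts H1" "y \<in> b \<inter> verts H2" using a' b' by blast
    then show thesis using crossing_edge_through[of x y "{}"] True that by auto
  next
    case False
    then obtain x where x: "x \<in> a" "x \<in> b" by blast
    obtain e where "e \<in> crossing" "x \<in> e" "e \<noteq> a" "e \<noteq> b"
      using crossing_edge_through_vertex[OF x(1) a a b, of "{}"] by auto
    then show thesis using that x by blast
  qed
  obtain f where f: "f \<in> crossing" "f \<inter> a \<noteq> {}" "f \<inter> b = {}" "f \<noteq> a" "f \<noteq> b"
    using crossing_edge_separating[OF assms] .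
  obtain g where g: "g \<in> crossing" "g \<inter> b \<noteq> {}" "g \<inter> a = {}" "g \<noteq> b" "g \<noteq> a"
    using crossing_edge_separating[OF b a assms(3)[symmetric]] .
  obtain u where u: "u \<in> verts H1" "u \<notin> a" "u \<notin> b" using vertex1_outside_two_crossing[OF a b] .
  obtain v where v: "v \<in> verts H2" "v \<notin> a" "v \<notin> b" using vertex2_outside_two_crossing[OF a b] .
  have "card (a \<union> b) \<le> 2 * k" using card_Un_le[of a b] a'(2) b'(2) by simp
  then obtain h where h: "h \<in> crossing" "u \<in> h" "h \<inter> (a \<union> b) = {}"
    using crossing_edge_through[of u v "a \<union> b"] u v a'(1) b'(1) by blast
  show ?thesis unfolding realizes_all_def
  proof (intro conjI)
    show "\<exists>e\<in>join_edges. e \<noteq> a \<and> e \<noteq> b \<and> e \<inter> a \<noteq> {} \<and> e \<inter> b \<noteq> {}" using e by blast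
    show "\<exists>e\<in>join_edges. e \<noteq> a \<and> e \<noteq> b \<and> e \<inter> a \<noteq> {} \<and> e \<inter> b = {}" using f by blast
    show "\<exists>e\<in>join_edges. e \<noteq> a \<and> e \<noteq> b \<and> e \<inter> a = {} \<and> e \<inter> b \<noteq> {}" using g by blast
    show "\<exists>e\<in>join_edges. e \<noteq> a \<and> e \<noteq> b \<and> e \<inter> a = {} \<and> e \<inter> b = {}" using h u by blast
  qed
qed

lemma realizes_edges2_crossing:
  assumes "a \<in> edges H2" "b \<in> crossing"
  shows "realizes_all join_edges a b"
  using joinable.realizes_edges1_crossing[OF swap] assms
  by (simp add: crossing_swap Un_commute)

lemma two_line_ec_join: "two_line_ec (uniform_join k H1 H2)"
  unfolding two_line_ec_iff edges_join
proof (intro conjI ballI impI)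
  show "\<exists>e\<in>join_edges. \<exists>f\<in>join_edges. e \<noteq> f" using ec1 by (simp add: two_line_ec_def) blast
next
  fix a b assume ab: "a \<in> join_edges" "b \<in> join_edges" "a \<noteq> b"
  have within1: "realizes_all join_edges a b" if "a \<in> edges H1" "b \<in> edges H1"
    by (rule realizes_all_mono[OF two_line_ec_realizes[OF ec1 that ab(3)]]) auto
  have within2: "realizes_all join_edges a b" if "a \<in> edges H2" "b \<in> edges H2"
    by (rule realizes_all_mono[OF two_line_ec_realizes[OF ec2 that ab(3)]]) auto
  \<comment> \<open>Nine combinations arise below; the three mixed ones in the opposite order follow
    from \<open>realizes_all_commute\<close>.\<close>
  note different = realizes_edges1_edges2 realizes_edges1_crossing realizes_edges2_crossing
  from ab(1,2) show "realizes_all join_edges a b"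
    by (elim UnE) (simp_all add: within1 within2 different
        different[THEN realizes_all_commute[THEN iffD1]] realizes_crossing_crossing[OF _ _ ab(3)])
qed

end

theorem corollary16:
  fixes k :: nat and H1 H2 :: "'a hypergraph"
  assumes "k > 0"
    and "is_hypergraph H1" and "uniform k H1" and "two_line_ec H1"
    and "is_hypergraph H2" and "uniform k H2" and "two_line_ec H2"
    and "verts H1 \<inter> verts H2 = {}"
    and "verts H2 \<lesssim> verts H1"
    and "{..<2 * k - 1} \<lesssim> verts H2"
  shows "is_hypergraph (uniform_join k H1 H2) \<and>
         uniform k (uniform_join k H1 H2) \<and>
         two_line_ec (uniform_join k H1 H2)"
proof -
  \<comment> \<open>The lower bound for \<open>verts H1\<close> comes by transitivity from the one
    for \<open>verts H2\<close>.\<close>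
  have "joinable k H1 H2"
    using assms two_line_ec_uniform_ge_2[OF assms(4,3,1)] lepoll_trans[OF assms(10,9)]
    by unfold_locales auto
  then have "two_line_ec (uniform_join k H1 H2)" by (rule joinable.two_line_ec_join)
  moreover have "is_hypergraph (uniform_join k H1 H2)" "uniform k (uniform_join k H1 H2)"
    using assms(2,3,5,6) unfolding is_hypergraph_def uniform_def uniform_join_def by auto
  ultimately show ?thesis by blast
qed

end
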